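(* There exists an FBD-graph; that is, there exists a finite simple oriented graph $G=(V,E)$ with $E\neq\emptyset$ that contains no directed 3-cycle and in which every edge is blocked.
   Context: A finite simple oriented graph is a pair $G=(V,E)$ with $V$ a finite set and $E\subseteq\{(i,j)\in V\times V : i\neq j\}$ such that $(i,j)\in E$ implies $(j,i)\notin E$ (no 1-cycles and no 2-cycles). Vertices $a,b,c\in V$ form a (directed) 3-cycle iff $(a,b),(b,c),(c,a)\in E$. An edge $(a,b)\in E$ is blocked iff there is a vertex $c\in V$ with $(a,c),(c,b)\in E$. A graph is fully blocked iff all of its edges are blocked. An FBD-graph is a fully blocked, finite, non-empty (i.e. having at least one edge) simple oriented graph without directed 3-cycles. *)

theory Defs
  imports "Graph_Theory.Pair_Digraph"
begin

(* pair_digraph: finite vertex set, arcs are pairs of vertices, no loops. *)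
locale oriented_graph = pair_digraph +
  assumes no_2_cycles: "(i, j) \<in> parcs G \<Longrightarrow> (j, i) \<notin> parcs G"

definition directed_3_cycle :: "'a pair_pre_digraph \<Rightarrow> 'a \<Rightarrow> 'a \<Rightarrow> 'a \<Rightarrow> bool" where
  "directed_3_cycle G a b c \<longleftrightarrow>
     a \<in> pverts G \<and> b \<in> pverts G \<and> c \<in> pverts G \<and>
     (a, b) \<in> parcs G \<and> (b, c) \<in> parcs G \<and> (c, a) \<in> parcs G"

definition blocked :: "'a pair_pre_digraph \<Rightarrow> 'a \<times> 'a \<Rightarrow> bool" where
  "blocked G e \<longleftrightarrow> (\<exists>c \<in> pverts G. (fst e, c) \<in> parcs G \<and> (c, snd e) \<in> parcs G)"

definition fully_blocked :: "'a pair_pre_digraph \<Rightarrow> bool" where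
  "fully_blocked G \<longleftrightarrow> (\<forall>e \<in> parcs G. blocked G e)"

definition FBD_graph :: "'a pair_pre_digraph \<Rightarrow> bool" where
  "FBD_graph G \<longleftrightarrow>
     oriented_graph G \<and> parcs G \<noteq> {} \<and> fully_blocked G \<and>
     (\<nexists>a b c. directed_3_cycle G a b c)"

end

theory Submission
  imports Defs
begin

text \<open>
  The witness is the Cayley graph of the integers modulo 15 whose steps are the powers of two
  1, 2, 4, 8. Since \<open>2 ^ 4 = 1\<close> modulo 15, doubling permutes the steps, so every step \<open>s\<close> is
  \<open>t + t\<close> for another step \<open>t\<close>; an arc from \<open>a\<close> to \<open>a + s\<close> is therefore blocked by its
  midpoint \<open>a + t\<close> (\<open>step_is_double\<close>).

  A directed cycle of length \<open>n\<close> corresponds to \<open>n\<close> steps with sum 0 modulo 15. The number 15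
  is \<open>1 + 2 + 4 + 8\<close>, with four binary digits 1, so it is not a sum of at most three powers of
  two, while three steps add up to at most 24 and hence cannot reach 30. So there are no
  cycles of length 1, 2 or 3 (\<open>sum_of_three_steps\<close> and its two companions).
\<close>

definition steps :: "int set" where
  "steps = {1, 2, 4, 8}"

definition doubling_arcs :: "(nat \<times> nat) set" where
  "doubling_arcs = {(a, b). a < 15 \<and> b < 15 \<and> (int b - int a) mod 15 \<in> steps}"

definition doubling_graph :: "nat pair_pre_digraph" where
  "doubling_graph = \<lparr>pverts = {..<15}, parcs = doubling_arcs\<rparr>"

text \<open>Modulo 15, half of 1 is 8; this wrap-around is what closes the chain of halvings.\<close>

lemma step_is_double:
  assumes "s \<in> steps"
  obtains t where "t \<in> steps" "(t + t) mod 15 = s"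
proof -
  have "\<exists>t\<in>steps. (t + t) mod 15 = s"
    using assms by (auto simp: steps_def)
  then show ?thesis using that by blast
qed

lemma zero_not_step: "0 \<notin> steps"
  by (simp add: steps_def)

lemma sum_of_two_steps:
  assumes "s \<in> steps" "t \<in> steps"
  shows "(s + t) mod 15 \<noteq> 0"
  using assms by (auto simp: steps_def)

lemma sum_of_three_steps:
  assumes "s \<in> steps" "t \<in> steps" "u \<in> steps"
  shows "(s + t + u) mod 15 \<noteq> 0"
  using assms by (auto simp: steps_def)

lemma doubling_arcs_step:
  assumes "(a, b) \<in> doubling_arcs"
  shows "(int b - int a) mod 15 \<in> steps"
  using assms by (simp add: doubling_arcs_def)

lemma doubling_arcs_irrefl: "(a, a) \<notin> doubling_arcs"
  using doubling_arcs_step[of a a] zero_not_step by auto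

lemma doubling_arcs_asym:
  assumes "(a, b) \<in> doubling_arcs"
  shows "(b, a) \<notin> doubling_arcs"
proof
  assume "(b, a) \<in> doubling_arcs"
  with assms have "((int b - int a) mod 15 + (int a - int b) mod 15) mod 15 \<noteq> 0"
    by (intro sum_of_two_steps doubling_arcs_step)
  then show False by (simp add: mod_add_eq)
qed

lemma doubling_arcs_no_triangle:
  assumes "(a, b) \<in> doubling_arcs" "(b, c) \<in> doubling_arcs"
  shows "(c, a) \<notin> doubling_arcs"
proof
  assume "(c, a) \<in> doubling_arcs"
  with assms have
    "((int b - int a) mod 15 + (int c - int b) mod 15 + (int a - int c) mod 15) mod 15 \<noteq> 0"
    by (intro sum_of_three_steps doubling_arcs_step)
  then have "((int b - int a) + (int c - int b) + (int a - int c)) mod 15 \<noteq> 0"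
    by (metis mod_add_left_eq mod_add_right_eq)
  then show False by simp
qed

lemma doubling_arcs_midpoint:
  assumes ab: "(a, b) \<in> doubling_arcs"
  obtains c where "(a, c) \<in> doubling_arcs" "(c, b) \<in> doubling_arcs"
proof -
  obtain t where t: "t \<in> steps" and tt: "(t + t) mod 15 = (int b - int a) mod 15"
    using step_is_double[OF doubling_arcs_step[OF ab]] .
  define c where "c = nat ((int a + t) mod 15)"
  have c: "int c = (int a + t) mod 15"
    by (simp add: c_def)
  have "c < 15"
    using c by linarith
  have t_mod: "t mod 15 = t"
    using t by (auto simp: steps_def)
  have "(int c - int a) mod 15 = t"
    using c t_mod by (simp add: mod_simps)
  moreover have "(int b - int c) mod 15 = t"
  proof -
    have "(int b - int c) mod 15 = ((int b - int a) mod 15 - t) mod 15"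
      unfolding c by (simp add: mod_simps diff_diff_eq)
    also have "\<dots> = (t + t - t) mod 15"
      unfolding tt[symmetric] by (rule mod_diff_left_eq)
    finally show ?thesis using t_mod by simp
  qed
  ultimately have "(a, c) \<in> doubling_arcs" "(c, b) \<in> doubling_arcs"
    using ab t \<open>c < 15\<close> by (auto simp: doubling_arcs_def)
  then show ?thesis using that by blast
qed

lemma doubling_arcs_subset: "doubling_arcs \<subseteq> {..<15} \<times> {..<15}"
  by (auto simp: doubling_arcs_def)

lemma oriented_doubling_graph: "oriented_graph doubling_graph"
proof
  show "finite (parcs doubling_graph)"
    using finite_subset[OF doubling_arcs_subset] by (simp add: doubling_graph_def)
  show "(j, i) \<notin> parcs doubling_graph" if "(i, j) \<in> parcs doubling_graph" for i j
    using that doubling_arcs_asym by (simp add: doubling_graph_def)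
qed (use doubling_arcs_subset doubling_arcs_irrefl in \<open>auto simp: doubling_graph_def\<close>)

lemma fully_blocked_doubling_graph: "fully_blocked doubling_graph"
  unfolding fully_blocked_def blocked_def
proof
  fix e assume "e \<in> parcs doubling_graph"
  then have "(fst e, snd e) \<in> doubling_arcs"
    by (simp add: doubling_graph_def)
  then obtain c where "(fst e, c) \<in> doubling_arcs" "(c, snd e) \<in> doubling_arcs"
    by (rule doubling_arcs_midpoint)
  then show "\<exists>c\<in>pverts doubling_graph.
      (fst e, c) \<in> parcs doubling_graph \<and> (c, snd e) \<in> parcs doubling_graph"
    using doubling_arcs_subset by (auto simp: doubling_graph_def)
qed

theorem theorem2:
  shows "\<exists>G :: nat pair_pre_digraph. FBD_graph G"
proof
  have "(0, 1) \<in> doubling_arcs"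
    by (simp add: doubling_arcs_def steps_def)
  then have "parcs doubling_graph \<noteq> {}"
    by (auto simp: doubling_graph_def)
  moreover have "\<nexists>a b c. directed_3_cycle doubling_graph a b c"
  proof clarify
    fix a b c assume "directed_3_cycle doubling_graph a b c"
    then show False
      using doubling_arcs_no_triangle[of a b c]
      by (simp add: directed_3_cycle_def doubling_graph_def)
  qed
  ultimately show "FBD_graph doubling_graph"
    using oriented_doubling_graph fully_blocked_doubling_graph by (simp add: FBD_graph_def)
qed

end
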